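(* Let $a,b\in\mathbb{Q}_p$, $a\neq0$, be such that $\sqrt{a^2-4b}$ exists in $\mathbb{Q}_p$, and let $$f(x)=\frac{ax^2+bx}{x^2+ax+b},\qquad x\in\mathbb{Q}_p,\ x\neq\hat x_1,\hat x_2,$$ where $\hat x_1,\hat x_2$ are the zeros of $x^2+ax+b$. Let $A$ be the associated set of radii (defined in the context). Then for every $r\in A$ with $r>0$ and $S_r(0)\neq\emptyset$ (i.e. for any invariant sphere $S_r(0)$), the dynamical system $(S_r(0),f,\mu)$ is not ergodic, where $\mu$ is the normalized Haar measure on $S_r(0)$.
   Context: $p$ is a prime. Everything is taken in $\mathbb{Q}_p$: $S_r(0)=\{x\in\mathbb{Q}_p:|x|_p=r\}$, $V_\rho(c)=\{x\in\mathbb{Q}_p:|x-c|_p\leq\rho\}$. Put $\delta=|a|_p$, $\alpha=|\hat x_1|_p$, $\beta=|\hat x_2|_p$, the roots being labelled so that $\alpha\leq\beta$ (one has $\delta\le\max\{\alpha,\beta\}$). The set $A$ is: $A=\{r: 0\leq r<\alpha\}$ if $\delta\leq\alpha=\beta$, and $A=[0,\beta)\setminus\{\alpha\}$ if $\alpha<\beta=\delta$. For $r\in A$ the sphere $S_r(0)$ is invariant for $f$. Measure (the paper's definition): $\mathcal{B}$ is the algebra generated by the closed subsets of $S_r(0)$. The Haar measure $\bar\mu$ is determined by $\bar\mu(V_\rho(c))=\rho$, and what the paper calls the normalized Haar measure $\mu$ on $S_r(0)$ is the Haar measure scaled so that $\mu(V_\rho(c))=\rho/r$ for every ball $V_\rho(c)\subset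 S_r(0)$, with $\rho$ a value of $|\cdot|_p$, i.e. $\rho\in\{p^n:n\in\mathbb{Z}\}$. The map $f$ preserves $\mu$ on $S_r(0)$. Ergodicity (the paper's definition): $(X,T,\mu)$ is ergodic if for every invariant measurable set $V$ (i.e. $T(V)=V$) one has $\mu(V)=0$ or $\mu(V)=1$. *)

theory Defs
  imports "HOL-Analysis.Analysis" "Berlekamp_Zassenhaus.Finite_Field"
begin

definition rat_pabs :: "nat \<Rightarrow> rat \<Rightarrow> real" where
  "rat_pabs p q = (if q = 0 then 0 else
     real p powi (int (multiplicity (int p) (snd (quotient_of q)))
                - int (multiplicity (int p) (fst (quotient_of q)))))"

context
  fixes p :: nat
  assumes p: "prime p"
begin

lemma prime_elem_int_p: "prime_elem (int p)"
  using p by (simp add: prime_elem_iff_prime_abs)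

lemma p_gt_1: "real p > 1"
  using prime_gt_1_nat[OF p] by simp

lemma rat_pabs_0 [simp]: "rat_pabs p 0 = 0"
  by (simp add: rat_pabs_def)

lemma rat_pabs_fraction:
  assumes "m \<noteq> 0" "n \<noteq> 0"
  shows "rat_pabs p (of_int m / of_int n) =
    real p powi (int (multiplicity (int p) n) - int (multiplicity (int p) m))"
proof -
  define q :: rat where "q = of_int m / of_int n"
  obtain m' n' where q': "quotient_of q = (m', n')" by fastforce
  have n': "n' > 0" using quotient_of_denom_pos[OF q'] .
  have eq: "q = of_int m' / of_int n'" using quotient_of_div[OF q'] .
  have q0: "q \<noteq> 0" using assms by (simp add: q_def)
  hence m': "m' \<noteq> 0" using eq by auto
  have "(of_int (m * n') :: rat) = of_int (m' * n)"
    using eq q_def assms n' by (simp add: field_simps)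
  hence "m * n' = m' * n" by (simp only: of_int_eq_iff)
  hence "multiplicity (int p) (m * n') = multiplicity (int p) (m' * n)" by simp
  hence "multiplicity (int p) m + multiplicity (int p) n' =
         multiplicity (int p) m' + multiplicity (int p) n"
    using assms m' n' prime_elem_int_p by (simp add: prime_elem_multiplicity_mult_distrib)
  hence ex: "int (multiplicity (int p) n') - int (multiplicity (int p) m') =
      int (multiplicity (int p) n) - int (multiplicity (int p) m)"
    by linarith
  have "rat_pabs p q = real p powi (int (multiplicity (int p) n') - int (multiplicity (int p) m'))"
    using q0 q' by (simp add: rat_pabs_def)
  thus ?thesis unfolding ex by (simp only: q_def)
qed

lemma rat_fraction:
  obtains m n :: int where "(q::rat) = of_int m / of_int n" "n \<noteq> 0" "q \<noteq> 0 \<Longrightarrow> m \<noteq> 0"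
proof -
  obtain m n where q: "quotient_of q = (m, n)" by fastforce
  show ?thesis
    using that[of m n] quotient_of_div[OF q] quotient_of_denom_pos[OF q] by auto
qed

lemma rat_pabs_nonneg [simp]: "rat_pabs p q \<ge> 0"
  by (simp add: rat_pabs_def)

lemma rat_pabs_eq_0 [simp]: "rat_pabs p q = 0 \<longleftrightarrow> q = 0"
  using p_gt_1 by (simp add: rat_pabs_def)

lemma rat_pabs_mult: "rat_pabs p (x * y) = rat_pabs p x * rat_pabs p y"
proof (cases "x = 0 \<or> y = 0")
  case False
  obtain m n where x: "x = of_int m / of_int n" "n \<noteq> 0" "m \<noteq> 0"
    using rat_fraction[of x] False by metis
  obtain k l where y: "y = of_int k / of_int l" "l \<noteq> 0" "k \<noteq> 0"
    using rat_fraction[of y] False by metis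
  have "x * y = of_int (m * k) / of_int (n * l)" using x y by simp
  hence "rat_pabs p (x * y) = real p powi (int (multiplicity (int p) (n * l)) - int (multiplicity (int p) (m * k)))"
    using rat_pabs_fraction[of "m * k" "n * l"] x y by simp
  also have "\<dots> = real p powi ((int (multiplicity (int p) n) - int (multiplicity (int p) m))
      + (int (multiplicity (int p) l) - int (multiplicity (int p) k)))"
    using x y prime_elem_int_p by (simp add: prime_elem_multiplicity_mult_distrib algebra_simps)
  also have "\<dots> = rat_pabs p x * rat_pabs p y"
    using x y p_gt_1 by (simp add: rat_pabs_fraction power_int_add)
  finally show ?thesis .
qed auto

lemma rat_pabs_1 [simp]: "rat_pabs p 1 = 1"
  using rat_pabs_fraction[of 1 1] by simp

lemma rat_pabs_minus [simp]: "rat_pabs p (- x) = rat_pabs p x"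
proof -
  have "rat_pabs p (-1) * rat_pabs p (-1) = 1"
    using rat_pabs_mult[of "-1" "-1"] by simp
  hence "(rat_pabs p (-1))\<^sup>2 = 1\<^sup>2" by (simp add: power2_eq_square)
  hence "rat_pabs p (-1) = 1" by (rule power2_eq_imp_eq) auto
  thus ?thesis using rat_pabs_mult[of "-1" x] by simp
qed

lemma rat_pabs_minus_commute: "rat_pabs p (x - y) = rat_pabs p (y - x)"
  using rat_pabs_minus[of "x - y"] by simp

lemma rat_pabs_inverse: "rat_pabs p (inverse x) = inverse (rat_pabs p x)"
proof (cases "x = 0")
  case False
  hence "rat_pabs p x * rat_pabs p (inverse x) = 1"
    using rat_pabs_mult[of x "inverse x"] by simp
  thus ?thesis by (metis inverse_unique)
qed auto

lemma rat_pabs_ultra: "rat_pabs p (x + y) \<le> max (rat_pabs p x) (rat_pabs p y)"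
proof (cases "x = 0 \<or> y = 0 \<or> x + y = 0")
  case False
  obtain m n where x: "x = of_int m / of_int n" "n \<noteq> 0" "m \<noteq> 0"
    using rat_fraction[of x] False by metis
  obtain k l where y: "y = of_int k / of_int l" "l \<noteq> 0" "k \<noteq> 0"
    using rat_fraction[of y] False by metis
  define d where "d = n * l"
  have x': "x = of_int (m * l) / of_int d" and y': "y = of_int (k * n) / of_int d" and d: "d \<noteq> 0"
    using x y by (auto simp: d_def)
  have xy: "x + y = of_int (m * l + k * n) / of_int d"
    by (simp add: x' y' add_divide_distrib)
  have nz: "m * l \<noteq> 0" "k * n \<noteq> 0" using x y by auto
  have nz2: "m * l + k * n \<noteq> 0" using xy False by (metis div_0 of_int_0)
  let ?v = "\<lambda>i. multiplicity (int p) i"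
  let ?w = "min (?v (m * l)) (?v (k * n))"
  have "int p ^ ?w dvd m * l" "int p ^ ?w dvd k * n"
    by (meson multiplicity_dvd' min.cobounded1 min.cobounded2)+
  hence "int p ^ ?w dvd m * l + k * n" by (rule dvd_add)
  hence "?w \<le> ?v (m * l + k * n)"
    using nz2 prime_elem_int_p by (intro multiplicity_geI) auto
  hence "?v (m * l) \<le> ?v (m * l + k * n) \<or> ?v (k * n) \<le> ?v (m * l + k * n)"
    by linarith
  moreover have "real p powi (int (?v d) - int k) \<le> real p powi (int (?v d) - int l)" if "l \<le> k" for k l
    using that p_gt_1 by (intro power_int_increasing) auto
  ultimately have "rat_pabs p (x + y) \<le> rat_pabs p x \<or> rat_pabs p (x + y) \<le> rat_pabs p y"
    unfolding xy unfolding x' y' rat_pabs_fraction[OF nz2 d] rat_pabs_fraction[OF nz(1) d]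
      rat_pabs_fraction[OF nz(2) d] by blast
  thus ?thesis by auto
qed (auto simp: le_max_iff_disj)

lemma rat_pabs_ultra_diff: "rat_pabs p (x - y) \<le> max (rat_pabs p x) (rat_pabs p y)"
  using rat_pabs_ultra[of x "- y"] by simp

lemma rat_pabs_triangle: "rat_pabs p (x + y) \<le> rat_pabs p x + rat_pabs p y"
  using rat_pabs_ultra[of x y] rat_pabs_nonneg[of x] rat_pabs_nonneg[of y] by linarith

lemma rat_pabs_diff_abs: "\<bar>rat_pabs p x - rat_pabs p y\<bar> \<le> rat_pabs p (x - y)"
  using rat_pabs_triangle[of "x - y" y] rat_pabs_triangle[of "y - x" x] rat_pabs_minus_commute[of x y]
  by auto

end

definition pcauchy :: "nat \<Rightarrow> (nat \<Rightarrow> rat) \<Rightarrow> bool" where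
  "pcauchy p X \<longleftrightarrow> (\<forall>e>0. \<exists>k. \<forall>m\<ge>k. \<forall>n\<ge>k. rat_pabs p (X m - X n) < e)"

definition pnull :: "nat \<Rightarrow> (nat \<Rightarrow> rat) \<Rightarrow> bool" where
  "pnull p X \<longleftrightarrow> (\<lambda>n. rat_pabs p (X n)) \<longlonglongrightarrow> 0"

definition padic_rel :: "nat \<Rightarrow> (nat \<Rightarrow> rat) \<Rightarrow> (nat \<Rightarrow> rat) \<Rightarrow> bool" where
  "padic_rel p X Y \<longleftrightarrow> pcauchy p X \<and> pcauchy p Y \<and> pnull p (\<lambda>n. X n - Y n)"

context
  fixes p :: nat
  assumes p: "prime p"
begin

lemma pcauchy_const: "pcauchy p (\<lambda>_. q)"
  using p by (simp add: pcauchy_def)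

lemma pcauchy_add:
  assumes "pcauchy p X" "pcauchy p Y"
  shows "pcauchy p (\<lambda>n. X n + Y n)"
  unfolding pcauchy_def
proof (intro allI impI)
  fix e :: real assume e: "e > 0"
  obtain k where k: "\<And>m n. m \<ge> k \<Longrightarrow> n \<ge> k \<Longrightarrow> rat_pabs p (X m - X n) < e"
    using assms(1) e unfolding pcauchy_def by meson
  obtain l where l: "\<And>m n. m \<ge> l \<Longrightarrow> n \<ge> l \<Longrightarrow> rat_pabs p (Y m - Y n) < e"
    using assms(2) e unfolding pcauchy_def by meson
  have "rat_pabs p ((X m + Y m) - (X n + Y n)) < e" if "m \<ge> max k l" "n \<ge> max k l" for m n
    using rat_pabs_ultra[OF p, of "X m - X n" "Y m - Y n"] k[of m n] l[of m n] that
    by (simp add: algebra_simps)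
  thus "\<exists>k. \<forall>m\<ge>k. \<forall>n\<ge>k. rat_pabs p ((X m + Y m) - (X n + Y n)) < e" by blast
qed

lemma pcauchy_minus: "pcauchy p X \<Longrightarrow> pcauchy p (\<lambda>n. - X n)"
  unfolding pcauchy_def using rat_pabs_minus_commute[OF p] by (simp add: minus_diff_commute)

lemma pcauchy_norm_convergent:
  assumes "pcauchy p X"
  shows "convergent (\<lambda>n. rat_pabs p (X n))"
proof -
  have "Cauchy (\<lambda>n. rat_pabs p (X n))"
    unfolding Cauchy_def dist_real_def
    using assms rat_pabs_diff_abs[OF p] unfolding pcauchy_def by (meson le_less_trans)
  thus ?thesis by (simp add: Cauchy_convergent_iff)
qed

lemma pcauchy_bounded:
  assumes "pcauchy p X"
  obtains B where "B > 0" "\<And>n. rat_pabs p (X n) \<le> B"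
proof -
  have "Bseq (\<lambda>n. rat_pabs p (X n))"
    using pcauchy_norm_convergent[OF assms] convergent_imp_Bseq by blast
  thus ?thesis using that p unfolding Bseq_def by auto
qed

lemma pcauchy_mult:
  assumes "pcauchy p X" "pcauchy p Y"
  shows "pcauchy p (\<lambda>n. X n * Y n)"
  unfolding pcauchy_def
proof (intro allI impI)
  fix e :: real assume e: "e > 0"
  obtain B where B: "B > 0" "\<And>n. rat_pabs p (X n) \<le> B" using pcauchy_bounded[OF assms(1)] by blast
  obtain C where C: "C > 0" "\<And>n. rat_pabs p (Y n) \<le> C" using pcauchy_bounded[OF assms(2)] by blast
  obtain k where k: "\<And>m n. m \<ge> k \<Longrightarrow> n \<ge> k \<Longrightarrow> rat_pabs p (X m - X n) < e / C"
    using assms(1) e C(1) unfolding pcauchy_def by (meson divide_pos_pos)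
  obtain l where l: "\<And>m n. m \<ge> l \<Longrightarrow> n \<ge> l \<Longrightarrow> rat_pabs p (Y m - Y n) < e / B"
    using assms(2) e B(1) unfolding pcauchy_def by (meson divide_pos_pos)
  have "rat_pabs p (X m * Y m - X n * Y n) < e" if mn: "m \<ge> max k l" "n \<ge> max k l" for m n
  proof -
    have 1: "rat_pabs p (X m) * rat_pabs p (Y m - Y n) < e"
    proof -
      have "rat_pabs p (X m) * rat_pabs p (Y m - Y n) \<le> B * rat_pabs p (Y m - Y n)"
        using B p by (intro mult_right_mono) auto
      also have "\<dots> < e" using l[of m n] mn B(1) by (simp add: field_simps)
      finally show ?thesis .
    qed
    have 2: "rat_pabs p (X m - X n) * rat_pabs p (Y n) < e"
    proof -
      have "rat_pabs p (X m - X n) * rat_pabs p (Y n) \<le> rat_pabs p (X m - X n) * C"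
        using C p by (intro mult_left_mono) auto
      also have "\<dots> < e" using k[of m n] mn C(1) by (simp add: field_simps)
      finally show ?thesis .
    qed
    have "X m * Y m - X n * Y n = X m * (Y m - Y n) + (X m - X n) * Y n"
      by (simp add: algebra_simps)
    thus ?thesis
      using 1 2 rat_pabs_ultra[OF p, of "X m * (Y m - Y n)" "(X m - X n) * Y n"]
      by (simp add: rat_pabs_mult[OF p])
  qed
  thus "\<exists>k. \<forall>m\<ge>k. \<forall>n\<ge>k. rat_pabs p (X m * Y m - X n * Y n) < e" by blast
qed

lemma pcauchy_not_null:
  assumes "pcauchy p X" "\<not> pnull p X"
  obtains b k where "b > 0" "\<And>n. n \<ge> k \<Longrightarrow> b < rat_pabs p (X n)"
proof -
  obtain L where L: "(\<lambda>n. rat_pabs p (X n)) \<longlonglongrightarrow> L"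
    using pcauchy_norm_convergent[OF assms(1)] by (auto simp: convergent_def)
  have "L \<ge> 0" using L by (rule LIMSEQ_le_const) (use p in auto)
  hence "L / 2 > 0" "L / 2 < L" using L assms(2) by (cases "L = 0"; auto simp: pnull_def)+
  moreover from this have "eventually (\<lambda>n. L / 2 < rat_pabs p (X n)) sequentially"
    using L by (intro order_tendstoD(1)) auto
  ultimately show ?thesis using that unfolding eventually_sequentially by blast
qed

lemma pcauchy_inverse:
  assumes "pcauchy p X" "\<not> pnull p X"
  shows "pcauchy p (\<lambda>n. inverse (X n))"
  unfolding pcauchy_def
proof (intro allI impI)
  fix e :: real assume e: "e > 0"
  obtain b l where b: "b > 0" "\<And>n. n \<ge> l \<Longrightarrow> b < rat_pabs p (X n)"
    using pcauchy_not_null[OF assms] by blast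
  obtain k where k: "\<And>m n. m \<ge> k \<Longrightarrow> n \<ge> k \<Longrightarrow> rat_pabs p (X m - X n) < e * (b * b)"
    using assms(1) e b(1) unfolding pcauchy_def by (meson mult_pos_pos)
  have "rat_pabs p (inverse (X m) - inverse (X n)) < e" if mn: "m \<ge> max k l" "n \<ge> max k l" for m n
  proof -
    have bm: "b < rat_pabs p (X m)" and bn: "b < rat_pabs p (X n)" using b(2) mn by auto
    hence nz: "X m \<noteq> 0" "X n \<noteq> 0" using b(1) p by auto
    hence eq: "(inverse (X m) - inverse (X n)) * (X m * X n) = X n - X m"
      by (simp add: field_simps)
    have "rat_pabs p (inverse (X m) - inverse (X n)) * (b * b)
        \<le> rat_pabs p (inverse (X m) - inverse (X n)) * (rat_pabs p (X m) * rat_pabs p (X n))"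
      using bm bn b(1) p by (intro mult_left_mono mult_mono) auto
    also have "\<dots> = rat_pabs p (X n - X m)"
      using arg_cong[OF eq, of "rat_pabs p"] by (simp add: rat_pabs_mult[OF p])
    also have "\<dots> < e * (b * b)" using k mn by auto
    finally show ?thesis using b(1) by simp
  qed
  thus "\<exists>k. \<forall>m\<ge>k. \<forall>n\<ge>k. rat_pabs p (inverse (X m) - inverse (X n)) < e" by blast
qed

lemma pnull_0: "pnull p (\<lambda>_. 0)"
  using p by (simp add: pnull_def)

lemma pnull_minus: "pnull p X \<Longrightarrow> pnull p (\<lambda>n. - X n)"
  using p by (simp add: pnull_def)

lemma pnull_add:
  assumes "pnull p X" "pnull p Y"
  shows "pnull p (\<lambda>n. X n + Y n)"
proof -
  have "(\<lambda>n. rat_pabs p (X n) + rat_pabs p (Y n)) \<longlonglongrightarrow> 0"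
    using tendsto_add[OF assms[unfolded pnull_def]] by simp
  thus ?thesis unfolding pnull_def
    by (rule tendsto_sandwich[rotated 2, OF tendsto_const]) (use rat_pabs_triangle[OF p] p in auto)
qed

lemma pnull_mult:
  assumes "pcauchy p X" "pnull p Y"
  shows "pnull p (\<lambda>n. X n * Y n)"
proof -
  obtain L where "(\<lambda>n. rat_pabs p (X n)) \<longlonglongrightarrow> L"
    using pcauchy_norm_convergent[OF assms(1)] by (auto simp: convergent_def)
  from tendsto_mult[OF this assms(2)[unfolded pnull_def]]
  show ?thesis by (simp add: pnull_def rat_pabs_mult[OF p])
qed

lemma pnull_diff_norm:
  assumes "pnull p (\<lambda>n. X n - Y n)"
  shows "(\<lambda>n. rat_pabs p (X n) - rat_pabs p (Y n)) \<longlonglongrightarrow> 0"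
proof (rule tendsto_rabs_zero_cancel, rule tendsto_sandwich[OF _ _ tendsto_const])
  show "(\<lambda>n. rat_pabs p (X n - Y n)) \<longlonglongrightarrow> 0" using assms by (simp add: pnull_def)
qed (use rat_pabs_diff_abs[OF p] in auto)

lemma pnull_cong:
  assumes "pnull p (\<lambda>n. X n - Y n)"
  shows "pnull p X \<longleftrightarrow> pnull p Y"
proof -
  have "pnull p X" if "pnull p Y" using pnull_add[OF assms that] by simp
  moreover have "pnull p Y" if "pnull p X" using pnull_add[OF that pnull_minus[OF assms]] by simp
  ultimately show ?thesis by blast
qed

lemma padic_rel_part_equivp: "part_equivp (padic_rel p)"
proof (rule part_equivpI)
  show "\<exists>x. padic_rel p x x"
    by (rule exI[of _ "\<lambda>_. 0"]) (simp add: padic_rel_def pcauchy_const pnull_0)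
  show "symp (padic_rel p)"
    by (rule sympI) (auto simp: padic_rel_def dest: pnull_minus)
  show "transp (padic_rel p)"
  proof (rule transpI)
    fix X Y Z assume "padic_rel p X Y" "padic_rel p Y Z"
    thus "padic_rel p X Z" using pnull_add[of "\<lambda>n. X n - Y n" "\<lambda>n. Y n - Z n"]
      by (auto simp: padic_rel_def)
  qed
qed

lemma padic_rel_add:
  "padic_rel p X X' \<Longrightarrow> padic_rel p Y Y' \<Longrightarrow> padic_rel p (\<lambda>n. X n + Y n) (\<lambda>n. X' n + Y' n)"
  using pnull_add[of "\<lambda>n. X n - X' n" "\<lambda>n. Y n - Y' n"]
  by (auto simp: padic_rel_def pcauchy_add add_diff_add)

lemma padic_rel_minus:
  "padic_rel p X X' \<Longrightarrow> padic_rel p (\<lambda>n. - X n) (\<lambda>n. - X' n)"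
  using pnull_minus[of "\<lambda>n. X n - X' n"]
  by (auto simp: padic_rel_def pcauchy_minus minus_diff_commute)

lemma padic_rel_mult:
  assumes "padic_rel p X X'" "padic_rel p Y Y'"
  shows "padic_rel p (\<lambda>n. X n * Y n) (\<lambda>n. X' n * Y' n)"
proof -
  have "pnull p (\<lambda>n. X n * (Y n - Y' n) + Y' n * (X n - X' n))"
    using assms by (intro pnull_add pnull_mult) (auto simp: padic_rel_def)
  also have "(\<lambda>n. X n * (Y n - Y' n) + Y' n * (X n - X' n)) = (\<lambda>n. X n * Y n - X' n * Y' n)"
    by (simp add: algebra_simps)
  finally show ?thesis using assms by (auto simp: padic_rel_def pcauchy_mult)
qed

lemma padic_rel_inverse_aux:
  assumes "pcauchy p X" "\<not> pnull p X"
  shows "pnull p (\<lambda>n. inverse (X n) * X n - 1)"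
proof -
  obtain b k where b: "b > 0" "\<And>n. n \<ge> k \<Longrightarrow> b < rat_pabs p (X n)"
    using pcauchy_not_null[OF assms] by blast
  have "X n \<noteq> 0" if "n \<ge> k" for n using b(1) b(2)[OF that] p by auto
  hence "rat_pabs p (inverse (X n) * X n - 1) = 0" if "n \<ge> k" for n
    using that p by simp
  hence "eventually (\<lambda>n. rat_pabs p (inverse (X n) * X n - 1) = 0) sequentially"
    unfolding eventually_sequentially by blast
  thus ?thesis unfolding pnull_def by (rule tendsto_eventually)
qed

lemma padic_rel_inverse:
  assumes "padic_rel p X X'"
  shows "padic_rel p (if pnull p X then \<lambda>_. 0 else (\<lambda>n. inverse (X n)))
                     (if pnull p X' then \<lambda>_. 0 else (\<lambda>n. inverse (X' n)))"
proof (cases "pnull p X")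
  case True
  thus ?thesis using assms pnull_cong[of X X'] by (auto simp: padic_rel_def pcauchy_const pnull_0)
next
  case False
  hence F': "\<not> pnull p X'" using assms pnull_cong[of X X'] by (auto simp: padic_rel_def)
  have c: "pcauchy p X" "pcauchy p X'" and d: "pnull p (\<lambda>n. X n - X' n)"
    using assms by (auto simp: padic_rel_def)
  note ci = pcauchy_inverse[OF c(1) False] pcauchy_inverse[OF c(2) F']
  have "pnull p (\<lambda>n. inverse (X n) * - (inverse (X' n) * X' n - 1)
      + inverse (X' n) * (inverse (X n) * X n - 1)
      + inverse (X n) * inverse (X' n) * - (X n - X' n))"
    by (intro pnull_add pnull_mult pnull_minus pcauchy_mult ci d
        padic_rel_inverse_aux c False F')
  also have "(\<lambda>n. inverse (X n) * - (inverse (X' n) * X' n - 1)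
      + inverse (X' n) * (inverse (X n) * X n - 1)
      + inverse (X n) * inverse (X' n) * - (X n - X' n)) = (\<lambda>n. inverse (X n) - inverse (X' n))"
    by (simp add: algebra_simps)
  finally show ?thesis using False F' ci by (simp add: padic_rel_def)
qed

lemma padic_rel_norm:
  assumes "padic_rel p X X'"
  shows "lim (\<lambda>n. rat_pabs p (X n)) = lim (\<lambda>n. rat_pabs p (X' n))"
proof -
  obtain L where L: "(\<lambda>n. rat_pabs p (X n)) \<longlonglongrightarrow> L"
    using assms pcauchy_norm_convergent by (auto simp: convergent_def padic_rel_def)
  have "(\<lambda>n. rat_pabs p (X' n)) \<longlonglongrightarrow> L"
  proof -
    have "pnull p (\<lambda>n. X n - X' n)" using assms by (simp add: padic_rel_def)
    from tendsto_diff[OF L pnull_diff_norm[OF this]] show ?thesis by simp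
  qed
  from limI[OF L] limI[OF this] show ?thesis by (rule trans[OF _ sym])
qed

end

text \<open>The prime \<open>p\<close> is the cardinality of the type argument; \<open>'p padic\<close> is the
  completion of the rationals with respect to the \<open>p\<close>-adic absolute value for \<open>p = CARD('p)\<close>.\<close>

typedef ('p::prime_card) padic =
    "{S. \<exists>X. padic_rel CARD('p) X X \<and> S = {Y. padic_rel CARD('p) X Y}}"
proof -
  have "padic_rel CARD('p) (\<lambda>_. 0) (\<lambda>_. 0)"
    by (simp add: padic_rel_def pcauchy_const[OF prime_card] pnull_0[OF prime_card])
  thus ?thesis by blast
qed

definition padic_of_seq :: "(nat \<Rightarrow> rat) \<Rightarrow> 'p::prime_card padic" where
  "padic_of_seq X = Abs_padic {Y. padic_rel CARD('p) X Y}"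

definition seq_of_padic :: "'p::prime_card padic \<Rightarrow> nat \<Rightarrow> rat" where
  "seq_of_padic x = (SOME X. X \<in> Rep_padic x)"

definition cr_padic :: "(nat \<Rightarrow> rat) \<Rightarrow> 'p::prime_card padic \<Rightarrow> bool" where
  "cr_padic = (\<lambda>X x. padic_rel CARD('p) X X \<and> padic_of_seq X = x)"

lemma Quotient_padic:
  "Quotient (padic_rel CARD('p)) padic_of_seq seq_of_padic
     (cr_padic :: (nat \<Rightarrow> rat) \<Rightarrow> 'p::prime_card padic \<Rightarrow> bool)"
proof -
  let ?R = "padic_rel CARD('p)"
  have pe: "part_equivp ?R" by (rule padic_rel_part_equivp[OF prime_card])
  note sym = part_equivp_symp[OF pe] and trans = part_equivp_transp[OF pe]
  have rep: "?R (seq_of_padic x) (seq_of_padic x) \<and> Rep_padic x = {Y. ?R (seq_of_padic x) Y}"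
    for x :: "'p padic"
  proof -
    obtain X where X: "?R X X" "Rep_padic x = {Y. ?R X Y}"
      using Rep_padic[of x] by blast
    hence "?R X (seq_of_padic x)"
      unfolding seq_of_padic_def by (metis (mono_tags) mem_Collect_eq someI)
    thus ?thesis using X(2) by (metis (no_types, lifting) Collect_cong sym trans)
  qed
  have eq: "?R X Y \<longleftrightarrow> ?R X X \<and> ?R Y Y \<and> (padic_of_seq X :: 'p padic) = padic_of_seq Y" for X Y
  proof -
    have "(padic_of_seq X :: 'p padic) = padic_of_seq Y \<longleftrightarrow> {Z. ?R X Z} = {Z. ?R Y Z}"
      if "?R X X" "?R Y Y"
      unfolding padic_of_seq_def by (rule Abs_padic_inject) (use that in auto)
    moreover have "{Z. ?R X Z} = {Z. ?R Y Z} \<longleftrightarrow> ?R X Y" if "?R X X" "?R Y Y"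
      using that sym trans by blast
    moreover have "?R X X \<and> ?R Y Y" if "?R X Y"
      using that sym trans by blast
    ultimately show ?thesis by blast
  qed
  have abs_rep: "padic_of_seq (seq_of_padic x) = x" for x :: "'p padic"
    unfolding padic_of_seq_def by (metis rep Rep_padic_inverse)
  show ?thesis
  proof (rule QuotientI)
    show "padic_of_seq (seq_of_padic x) = x" for x :: "'p padic" by (rule abs_rep)
    show "?R (seq_of_padic x) (seq_of_padic x)" for x :: "'p padic" using rep by blast
    show "?R X Y \<longleftrightarrow> ?R X X \<and> ?R Y Y \<and> (padic_of_seq X :: 'p padic) = padic_of_seq Y" for X Y
      by (rule eq)
  qed (simp add: cr_padic_def)
qed

setup_lifting Quotient_padic

instantiation padic :: (prime_card) field
begin

lift_definition zero_padic :: "'a padic" is "\<lambda>_. 0"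
  by (simp add: padic_rel_def pcauchy_const[OF prime_card] pnull_0[OF prime_card])

lift_definition one_padic :: "'a padic" is "\<lambda>_. 1"
  by (simp add: padic_rel_def pcauchy_const[OF prime_card] pnull_0[OF prime_card])

lift_definition plus_padic :: "'a padic \<Rightarrow> 'a padic \<Rightarrow> 'a padic" is "\<lambda>X Y n. X n + Y n"
  by (rule padic_rel_add[OF prime_card])

lift_definition uminus_padic :: "'a padic \<Rightarrow> 'a padic" is "\<lambda>X n. - X n"
  by (rule padic_rel_minus[OF prime_card])

lift_definition times_padic :: "'a padic \<Rightarrow> 'a padic \<Rightarrow> 'a padic" is "\<lambda>X Y n. X n * Y n"
  by (rule padic_rel_mult[OF prime_card])

lift_definition inverse_padic :: "'a padic \<Rightarrow> 'a padic"
  is "\<lambda>X. if pnull CARD('a) X then \<lambda>_. 0 else (\<lambda>n. inverse (X n))"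
  by (rule padic_rel_inverse[OF prime_card])

definition minus_padic :: "'a padic \<Rightarrow> 'a padic \<Rightarrow> 'a padic" where "minus_padic x y = x + - y"

definition divide_padic :: "'a padic \<Rightarrow> 'a padic \<Rightarrow> 'a padic" where "divide_padic x y = x * inverse y"

instance
proof
  note [simp] = pnull_0[OF prime_card]
  note [simp] = pcauchy_add[OF prime_card] pcauchy_mult[OF prime_card] pcauchy_minus[OF prime_card]
    pcauchy_const[OF prime_card]
  fix a b c :: "'a padic"
  show "a + b + c = a + (b + c)" by transfer (simp add: padic_rel_def algebra_simps)
  show "a + b = b + a" by transfer (simp add: padic_rel_def algebra_simps)
  show "0 + a = a" by transfer (simp add: padic_rel_def)
  show "- a + a = 0" by transfer (simp add: padic_rel_def)
  show "a - b = a + - b" by (simp add: minus_padic_def)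
  show "a * b * c = a * (b * c)" by transfer (simp add: padic_rel_def algebra_simps)
  show "a * b = b * a" by transfer (simp add: padic_rel_def algebra_simps)
  show "1 * a = a" by transfer (simp add: padic_rel_def)
  show "(a + b) * c = a * c + b * c" by transfer (simp add: padic_rel_def algebra_simps)
  show "(0::'a padic) \<noteq> 1"
    by transfer (simp add: padic_rel_def pnull_def LIMSEQ_const_iff rat_pabs_minus[OF prime_card] rat_pabs_1[OF prime_card])
  show "a \<noteq> 0 \<Longrightarrow> inverse a * a = 1"
  proof transfer
    fix X assume X: "padic_rel CARD('a) X X" "\<not> padic_rel CARD('a) X (\<lambda>_. 0)"
    hence c: "pcauchy CARD('a) X" and n: "\<not> pnull CARD('a) X"
      by (auto simp: padic_rel_def)
    from c n show "padic_rel CARD('a) (\<lambda>n. (if pnull CARD('a) X then \<lambda>_. 0 else (\<lambda>n. inverse (X n))) n * X n) (\<lambda>_. 1)"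
      using padic_rel_inverse_aux[OF prime_card c n] pcauchy_inverse[OF prime_card c n]
      by (simp add: padic_rel_def)
  qed
  show "a div b = a * inverse b" by (simp add: divide_padic_def)
  show "inverse (0::'a padic) = 0" by transfer (simp add: padic_rel_def)
qed

end

lift_definition padic_norm :: "'a::prime_card padic \<Rightarrow> real" is "\<lambda>X. lim (\<lambda>n. rat_pabs CARD('a) (X n))"
  by (rule padic_rel_norm[OF prime_card])

lemma padic_seq_limit:
  assumes "padic_rel CARD('a::prime_card) X X"
  shows "(\<lambda>n. rat_pabs CARD('a) (X n)) \<longlonglongrightarrow> lim (\<lambda>n. rat_pabs CARD('a) (X n))"
  using assms pcauchy_norm_convergent[OF prime_card] convergent_LIMSEQ_iff
  by (auto simp: padic_rel_def)

lemma padic_norm_eq_0: "padic_norm (x :: 'a::prime_card padic) = 0 \<longleftrightarrow> x = 0"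
proof transfer
  fix X assume X: "padic_rel CARD('a) X X"
  have "lim (\<lambda>n. rat_pabs CARD('a) (X n)) = 0 \<longleftrightarrow> pnull CARD('a) X"
    using padic_seq_limit[OF X] by (metis limI pnull_def)
  thus "lim (\<lambda>n. rat_pabs CARD('a) (X n)) = 0 \<longleftrightarrow> padic_rel CARD('a) X (\<lambda>_. 0)"
    using X by (simp add: padic_rel_def pcauchy_const[OF prime_card])
qed

lemma padic_norm_minus: "padic_norm (- x :: 'a::prime_card padic) = padic_norm x"
  by transfer (simp add: rat_pabs_minus[OF prime_card])

lemma padic_norm_mult: "padic_norm (x * y :: 'a::prime_card padic) = padic_norm x * padic_norm y"
proof transfer
  fix X Y assume "padic_rel CARD('a) X X" "padic_rel CARD('a) Y Y"
  from tendsto_mult[OF this[THEN padic_seq_limit]]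
  show "lim (\<lambda>n. rat_pabs CARD('a) (X n * Y n)) =
      lim (\<lambda>n. rat_pabs CARD('a) (X n)) * lim (\<lambda>n. rat_pabs CARD('a) (Y n))"
    by (intro limI) (simp add: rat_pabs_mult[OF prime_card])
qed

lemma padic_norm_ultra: "padic_norm (x + y :: 'a::prime_card padic) \<le> max (padic_norm x) (padic_norm y)"
proof transfer
  fix X Y assume X: "padic_rel CARD('a) X X" and Y: "padic_rel CARD('a) Y Y"
  have XY: "padic_rel CARD('a) (\<lambda>n. X n + Y n) (\<lambda>n. X n + Y n)"
    by (rule padic_rel_add[OF prime_card X Y])
  show "lim (\<lambda>n. rat_pabs CARD('a) (X n + Y n)) \<le>
      max (lim (\<lambda>n. rat_pabs CARD('a) (X n))) (lim (\<lambda>n. rat_pabs CARD('a) (Y n)))"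
    by (rule LIMSEQ_le[OF padic_seq_limit[OF XY]
          tendsto_max[OF padic_seq_limit[OF X] padic_seq_limit[OF Y]]])
      (use rat_pabs_ultra[OF prime_card] in blast)
qed

lemma padic_norm_nonneg: "padic_norm (x :: 'a::prime_card padic) \<ge> 0"
  using padic_norm_ultra[of x "- x"] padic_norm_eq_0[of "0 :: 'a padic"] by (simp add: padic_norm_minus)

instantiation padic :: (prime_card) metric_space
begin

definition dist_padic :: "'a padic \<Rightarrow> 'a padic \<Rightarrow> real" where
  "dist_padic x y = padic_norm (x - y)"

definition uniformity_padic :: "('a padic \<times> 'a padic) filter" where
  "uniformity_padic = (INF e\<in>{0<..}. principal {(x, y). dist x y < e})"

definition open_padic :: "'a padic set \<Rightarrow> bool" where
  "open_padic U = (\<forall>x\<in>U. eventually (\<lambda>(x', y). x' = x \<longrightarrow> y \<in> U) uniformity)"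

instance
proof
  fix x y z :: "'a padic" and U :: "'a padic set"
  show "uniformity = (INF e\<in>{0<..}. principal {(x, y :: 'a padic). dist x y < e})"
    by (rule uniformity_padic_def)
  show "open U \<longleftrightarrow> (\<forall>x\<in>U. eventually (\<lambda>(x', y). x' = x \<longrightarrow> y \<in> U) uniformity)"
    by (rule open_padic_def)
  show "dist x y = 0 \<longleftrightarrow> x = y"
    by (simp add: dist_padic_def padic_norm_eq_0)
  have "padic_norm (x - y) \<le> max (padic_norm (x - z)) (padic_norm (z - y))"
    using padic_norm_ultra[of "x - z" "z - y"] by simp
  thus "dist x y \<le> dist x z + dist y z"
    using padic_norm_minus[of "z - y"] padic_norm_nonneg[of "x - z"] padic_norm_nonneg[of "z - y"]
    by (simp add: dist_padic_def)
qed

end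

lemma padic_norm_of_rat:
  "padic_norm (padic_of_seq (\<lambda>_. q) :: 'p::prime_card padic) = rat_pabs CARD('p) q"
proof -
  have "padic_rel CARD('p) (\<lambda>_. q) (\<lambda>_. q)"
    by (simp add: padic_rel_def pcauchy_const[OF prime_card] pnull_0[OF prime_card])
  thus ?thesis by (simp add: padic_norm.abs_eq)
qed

lemma padic_of_seq_diff:
  assumes "pcauchy CARD('p) X" "pcauchy CARD('p) Y"
  shows "(padic_of_seq X - padic_of_seq Y :: 'p::prime_card padic) = padic_of_seq (\<lambda>n. X n - Y n)"
proof -
  have refl: "padic_rel CARD('p) Z Z" if "pcauchy CARD('p) Z" for Z
    using that by (simp add: padic_rel_def pnull_0[OF prime_card])
  show ?thesis
    using assms pcauchy_minus[OF prime_card assms(2)] unfolding minus_padic_def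
    by (simp add: uminus_padic.abs_eq plus_padic.abs_eq refl)
qed

lemma padic_of_seq_tendsto:
  assumes X: "pcauchy CARD('p) X"
  shows "(\<lambda>k. padic_of_seq (\<lambda>_. X k)) \<longlonglongrightarrow> (padic_of_seq X :: 'p::prime_card padic)"
proof (rule metric_LIMSEQ_I)
  fix e :: real assume "e > 0"
  then obtain N where N: "\<And>m n. m \<ge> N \<Longrightarrow> n \<ge> N \<Longrightarrow> rat_pabs CARD('p) (X m - X n) < e / 2"
    using X unfolding pcauchy_def by (meson half_gt_zero)
  have "dist (padic_of_seq (\<lambda>_. X k)) (padic_of_seq X :: 'p padic) < e" if k: "k \<ge> N" for k
  proof -
    let ?Z = "\<lambda>n. X k - X n"
    have "pcauchy CARD('p) ?Z"
      using pcauchy_add[OF prime_card pcauchy_const[OF prime_card] pcauchy_minus[OF prime_card X]]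
      by simp
    hence Z: "padic_rel CARD('p) ?Z ?Z"
      by (simp add: padic_rel_def pnull_0[OF prime_card])
    have "dist (padic_of_seq (\<lambda>_. X k)) (padic_of_seq X :: 'p padic)
        = lim (\<lambda>n. rat_pabs CARD('p) (?Z n))"
      using Z by (simp add: dist_padic_def padic_of_seq_diff pcauchy_const[OF prime_card] X padic_norm.abs_eq)
    also have "\<dots> \<le> e / 2"
      by (rule LIMSEQ_le_const2[OF padic_seq_limit[OF Z]]) (use N k in \<open>auto intro!: exI[of _ N] less_imp_le\<close>)
    finally show ?thesis using \<open>e > 0\<close> by simp
  qed
  thus "\<exists>N. \<forall>k\<ge>N. dist (padic_of_seq (\<lambda>_. X k)) (padic_of_seq X :: 'p padic) < e" by blast
qed

lemma padic_rat_dense: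
  assumes "e > 0"
  obtains q where "dist (padic_of_seq (\<lambda>_. q)) (x :: 'p::prime_card padic) < e"
proof -
  obtain X where X: "pcauchy CARD('p) X" "x = padic_of_seq X"
    using Quotient_rep_reflp[OF Quotient_padic, of x] Quotient_abs_rep[OF Quotient_padic, of x]
    by (metis padic_rel_def)
  obtain k where "dist (padic_of_seq (\<lambda>_. X k)) x < e"
    using metric_LIMSEQ_D[OF padic_of_seq_tendsto[OF X(1)] assms] X(2) by blast
  thus ?thesis by (rule that)
qed

instance padic :: (prime_card) complete_space
proof
  fix x :: "nat \<Rightarrow> 'a padic" assume x: "Cauchy x"
  let ?c = "\<lambda>q. padic_of_seq (\<lambda>_. q) :: 'a padic"
  have "\<exists>q. dist (?c q) (x n) < 1 / real (Suc n)" for n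
    using padic_rat_dense[of "1 / real (Suc n)" "x n"] by auto
  then obtain Q where Q: "\<And>n. dist (?c (Q n)) (x n) < 1 / real (Suc n)" by metis
  have lim0: "(\<lambda>n. dist (?c (Q n)) (x n)) \<longlonglongrightarrow> 0"
  proof (rule tendsto_sandwich[OF _ _ tendsto_const LIMSEQ_inverse_real_of_nat])
    show "\<forall>\<^sub>F n in sequentially. dist (?c (Q n)) (x n) \<le> inverse (real (Suc n))"
      using Q by (intro always_eventually allI) (metis inverse_eq_divide less_imp_le)
  qed simp
  have dQ: "dist (?c q) (?c q') = rat_pabs CARD('a) (q - q')" for q q'
    by (simp add: dist_padic_def padic_of_seq_diff pcauchy_const[OF prime_card] padic_norm_of_rat)
  have "pcauchy CARD('a) Q"
    unfolding pcauchy_def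
  proof (intro allI impI)
    fix e :: real assume "e > 0"
    hence e: "e / 3 > 0" by simp
    obtain k where k: "\<And>m n. m \<ge> k \<Longrightarrow> n \<ge> k \<Longrightarrow> dist (x m) (x n) < e / 3"
      using x e unfolding Cauchy_def by meson
    obtain l where l: "\<And>n. n \<ge> l \<Longrightarrow> dist (?c (Q n)) (x n) < e / 3"
      using metric_LIMSEQ_D[OF lim0 e] by (auto simp: dist_real_def)
    have "rat_pabs CARD('a) (Q m - Q n) < e" if mn: "m \<ge> max k l" "n \<ge> max k l" for m n
    proof -
      have "dist (?c (Q m)) (?c (Q n)) \<le> dist (?c (Q m)) (x m) + dist (x m) (x n) + dist (?c (Q n)) (x n)"
        using dist_triangle[of "?c (Q m)" "?c (Q n)" "x m"] dist_triangle[of "x m" "?c (Q n)" "x n"]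
          dist_commute[of "x n" "?c (Q n)"] by linarith
      also have "\<dots> < e" using k[of m n] l[of m] l[of n] mn by auto
      finally show ?thesis by (simp add: dQ)
    qed
    thus "\<exists>k. \<forall>m\<ge>k. \<forall>n\<ge>k. rat_pabs CARD('a) (Q m - Q n) < e" by blast
  qed
  from padic_of_seq_tendsto[OF this]
  have "(\<lambda>n. dist (?c (Q n)) (padic_of_seq Q)) \<longlonglongrightarrow> 0"
    by (rule tendsto_dist_iff[THEN iffD1])
  hence lim: "(\<lambda>n. dist (?c (Q n)) (x n) + dist (?c (Q n)) (padic_of_seq Q)) \<longlonglongrightarrow> 0"
    using tendsto_add[OF lim0] by fastforce
  have "(\<lambda>n. dist (x n) (padic_of_seq Q)) \<longlonglongrightarrow> 0"
  proof (rule tendsto_sandwich[OF _ _ tendsto_const lim])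
    show "\<forall>\<^sub>F n in sequentially. dist (x n) (padic_of_seq Q)
        \<le> dist (?c (Q n)) (x n) + dist (?c (Q n)) (padic_of_seq Q)"
      by (intro always_eventually allI dist_triangle3)
  qed simp
  hence "x \<longlonglongrightarrow> padic_of_seq Q" by (rule tendsto_dist_iff[THEN iffD2])
  thus "convergent x" unfolding convergent_def by blast
qed

text \<open>The zeros of the denominator, where division by zero gives \<open>0\<close>, lie outside every sphere
  whose radius is in \<open>invariant_radii\<close> below.\<close>

definition rat_map :: "'p::prime_card padic \<Rightarrow> 'p padic \<Rightarrow> 'p padic \<Rightarrow> 'p padic" where
  "rat_map a b x = (a * x\<^sup>2 + b * x) / (x\<^sup>2 + a * x + b)"

text \<open>Here \<open>\<delta>\<close>, \<open>\<alpha>\<close>, \<open>\<beta>\<close> are the absolute values of \<open>a\<close> and of the smaller and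
  larger zero of \<open>x\<^sup>2 + a x + b\<close>; the last case never occurs for these.\<close>

definition invariant_radii :: "real \<Rightarrow> real \<Rightarrow> real \<Rightarrow> real set" where
  "invariant_radii \<delta> \<alpha> \<beta> =
     (if \<delta> \<le> \<alpha> \<and> \<alpha> = \<beta> then {0..<\<alpha>}
      else if \<alpha> < \<beta> \<and> \<beta> = \<delta> then {0..<\<beta>} - {\<alpha>}
      else {})"

definition padic_haar :: "'p::prime_card padic measure \<Rightarrow> bool" where
  "padic_haar M \<longleftrightarrow> sets M = sets borel \<and>
     (\<forall>c. \<forall>V\<in>sets borel. emeasure M ((\<lambda>x. c + x) ` V) = emeasure M V) \<and>
     (\<forall>c. \<forall>n::int. emeasure M (cball c (real CARD('p) powi n)) = ennreal (real CARD('p) powi n))"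

text \<open>This gives measure \<open>\<rho> / r\<close> to each ball of radius \<open>\<rho>\<close> (a power of \<open>p\<close>) inside the sphere,
  hence total mass \<open>1 - 1 / p\<close>, not \<open>1\<close>, to the sphere itself.\<close>

definition sphere_measure :: "'p::prime_card padic measure \<Rightarrow> real \<Rightarrow> 'p padic measure" where
  "sphere_measure M r = scale_measure (ennreal (1 / r)) (restrict_space M (sphere 0 r))"

definition closed_algebra :: "'a::topological_space set \<Rightarrow> 'a set set" where
  "closed_algebra X = \<Inter> {B. Sigma_Algebra.algebra X B \<and> {C. closedin (top_of_set X) C} \<subseteq> B}"

text \<open>The invariant sets range over the algebra (not \<open>\<sigma>\<close>-algebra) generated by the closed sets,
  and the value \<open>1\<close> is literal: it is not replaced by the total mass of \<open>\<mu>\<close>.\<close>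

definition ergodic :: "'a::topological_space set \<Rightarrow> ('a \<Rightarrow> 'a) \<Rightarrow> 'a measure \<Rightarrow> bool" where
  "ergodic X T \<mu> \<longleftrightarrow>
     (\<forall>V\<in>closed_algebra X. T ` V = V \<longrightarrow> emeasure \<mu> V = 0 \<or> emeasure \<mu> V = 1)"

end

theory Submission
  imports Defs
begin

text \<open>Since \<open>f(x) - x = - x\<^sup>3 / (x\<^sup>2 + a x + b)\<close>, the displacement \<open>|f(x) - x|\<close> takes a single value
  \<open>\<rho> < r\<close> on the sphere \<open>S\<^sub>r(0)\<close>, so \<open>f\<close> maps every ball of radius \<open>\<rho>\<close> in the sphere into itself. On such
  a ball the map \<open>x \<mapsto> x\<^sup>3 / (x\<^sup>2 + a x + b)\<close> is a contraction, so for each \<open>y\<close> the equation \<open>f(x) = y\<close>,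
  in the form \<open>x = y + x\<^sup>3 / (x\<^sup>2 + a x + b)\<close>, is solved by Banach's fixed point theorem. Hence these
  balls are strictly invariant, and they have measure \<open>\<rho> / r\<close>, which lies strictly between 0 and 1.\<close>

section \<open>The ultrametric absolute value\<close>

lemma padic_norm_1 [simp]: "padic_norm (1 :: 'p::prime_card padic) = 1"
proof -
  have "padic_norm (1 :: 'p padic) * padic_norm (1 :: 'p padic) = padic_norm (1 :: 'p padic)"
    using padic_norm_mult[of "1 :: 'p padic" 1] by simp
  thus ?thesis using padic_norm_eq_0[of "1 :: 'p padic"] by simp
qed

lemma padic_norm_power: "padic_norm (x ^ n :: 'p::prime_card padic) = padic_norm x ^ n"
  by (induction n) (simp_all add: padic_norm_mult)

lemma padic_norm_divide:
  "padic_norm (x / y :: 'p::prime_card padic) = padic_norm x / padic_norm y"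
proof (cases "y = 0")
  case False
  hence "padic_norm x = padic_norm (x / y) * padic_norm y"
    by (simp flip: padic_norm_mult)
  thus ?thesis using False by (simp add: padic_norm_eq_0)
qed (use padic_norm_eq_0[of "0 :: 'p padic"] in simp)

lemma padic_norm_minus_commute: "padic_norm (x - y :: 'p::prime_card padic) = padic_norm (y - x)"
  using padic_norm_minus[of "x - y"] by simp

lemma padic_norm_ultra_diff:
  "padic_norm (x - y :: 'p::prime_card padic) \<le> max (padic_norm x) (padic_norm y)"
  using padic_norm_ultra[of x "- y"] by (simp add: padic_norm_minus)

text \<open>If the left side were smaller, \<open>x = (x - y) + y\<close> would violate the strong
  triangle inequality.\<close>

lemma padic_norm_diff_eq_left:
  fixes x y :: "'p::prime_card padic"
  assumes "padic_norm y < padic_norm x"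
  shows "padic_norm (x - y) = padic_norm x"
  using padic_norm_ultra[of "x - y" y] padic_norm_ultra_diff[of x y] assms by auto

lemma padic_norm_diff_eq_max:
  fixes x y :: "'p::prime_card padic"
  assumes "padic_norm x \<noteq> padic_norm y"
  shows "padic_norm (x - y) = max (padic_norm x) (padic_norm y)"
proof (cases "padic_norm y < padic_norm x")
  case True
  thus ?thesis by (simp add: padic_norm_diff_eq_left)
next
  case False
  hence "padic_norm x < padic_norm y" using assms by simp
  thus ?thesis using padic_norm_diff_eq_left[of x y] by (simp add: padic_norm_minus_commute)
qed

lemma dist_0_padic: "dist 0 (x :: 'p::prime_card padic) = padic_norm x"
  by (simp add: dist_padic_def padic_norm_minus)

text \<open>Rationals are dense and the norm is locally constant away from 0, so \<open>x\<close>
  shares its norm with a rational. \<open>padic_haar\<close> prescribes the mass of balls only for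
  radii of this form.\<close>

lemma padic_norm_value:
  fixes x :: "'p::prime_card padic"
  assumes "x \<noteq> 0"
  obtains n :: int where "padic_norm x = real CARD('p) powi n"
proof -
  have "padic_norm x > 0"
    using assms padic_norm_nonneg[of x] padic_norm_eq_0[of x] by simp
  then obtain q where q: "dist (padic_of_seq (\<lambda>_. q)) x < padic_norm x"
    using padic_rat_dense by blast
  let ?q = "padic_of_seq (\<lambda>_. q) :: 'p padic"
  have "padic_norm (x - (x - ?q)) = padic_norm x"
    using q by (intro padic_norm_diff_eq_left) (simp add: dist_padic_def padic_norm_minus_commute)
  hence "padic_norm x = rat_pabs CARD('p) q" by (simp add: padic_norm_of_rat)
  moreover have "q \<noteq> 0"
    using calculation \<open>padic_norm x > 0\<close> by (auto simp: rat_pabs_def)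
  ultimately show ?thesis using that by (simp add: rat_pabs_def)
qed

section \<open>Roots and coefficients of a monic quadratic\<close>

text \<open>The set of roots carries no multiplicities, so the factorization has to be recovered.
  The reflection \<open>x \<mapsto> - a - x\<close> preserves this set. Unless it swaps
  \<open>x1\<close> and \<open>x2\<close> it fixes both, and then
  \<open>- a = 2 * x1 = 2 * x2\<close>: this forces \<open>a = 0\<close> in characteristic 2, and
  otherwise \<open>x1 = x2\<close>, whence again \<open>- a = x1 + x2\<close>.\<close>

lemma monic_quadratic_vieta:
  fixes a b x1 x2 :: "'a::field"
  assumes "a \<noteq> 0" and roots: "{x. x\<^sup>2 + a * x + b = 0} = {x1, x2}"
  shows "a = - (x1 + x2)" "b = x1 * x2"
proof -
  have root: "x\<^sup>2 + a * x + b = 0 \<longleftrightarrow> x = x1 \<or> x = x2" for x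
    using roots by blast
  have conj: "- a - x = x1 \<or> - a - x = x2" if "x = x1 \<or> x = x2" for x
  proof -
    have "(- a - x)\<^sup>2 + a * (- a - x) + b = x\<^sup>2 + a * x + b"
      by (simp add: power2_eq_square algebra_simps)
    thus ?thesis using root that by metis
  qed
  show a: "a = - (x1 + x2)"
  proof (rule ccontr)
    assume ne: "a \<noteq> - (x1 + x2)"
    have ne': "- a \<noteq> x1 + x2"
      using ne by (simp only: minus_equation_iff[of a] eq_commute[of _ a] simp_thms)
    have "- a - x1 = x1" using conj[of x1] ne' by (auto simp only: diff_eq_eq add.commute[of x2 x1])
    hence x1: "- a = 2 * x1" by (simp only: diff_eq_eq mult_2)
    have "- a - x2 = x2" using conj[of x2] ne' by (auto simp only: diff_eq_eq)
    hence x2: "- a = 2 * x2" by (simp only: diff_eq_eq mult_2)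
    show False
    proof (cases "(2 :: 'a) = 0")
      case True
      thus False using \<open>a \<noteq> 0\<close> x1 by (simp only: mult_zero_left neg_equal_0_iff_equal)
    next
      case False
      moreover have "2 * x1 = 2 * x2" using x1 x2 by (simp only:)
      ultimately have "x1 = x2" by simp
      thus False using ne' x1 by (simp only: mult_2 simp_thms)
    qed
  qed
  have "x1\<^sup>2 + a * x1 + b = 0" using root by blast
  thus "b = x1 * x2" by (simp add: a power2_eq_square algebra_simps)
qed

section \<open>Displacement and invariant balls\<close>

definition displacement :: "'p::prime_card padic \<Rightarrow> 'p padic \<Rightarrow> 'p padic \<Rightarrow> 'p padic" where
  "displacement a b x = x ^ 3 / (x\<^sup>2 + a * x + b)"

lemma rat_map_displacement:
  assumes "x\<^sup>2 + a * x + b \<noteq> 0"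
  shows "rat_map a b x = x - displacement a b x"
  using assms by (simp add: rat_map_def displacement_def field_simps power2_eq_square power3_eq_cube)

text \<open>Over the common denominator, the parts of the numerator with coefficients
  \<open>1\<close>, \<open>a\<close> and \<open>b\<close> are each divisible by
  \<open>x - y\<close>.\<close>

lemma displacement_diff:
  assumes "x\<^sup>2 + a * x + b \<noteq> 0" "y\<^sup>2 + a * y + b \<noteq> 0"
  shows "displacement a b x - displacement a b y =
    (x - y) * ((x * y)\<^sup>2 + a * (x * y * (x + y)) + b * (x\<^sup>2 + x * y + y\<^sup>2))
      / ((x\<^sup>2 + a * x + b) * (y\<^sup>2 + a * y + b))"
  using assms unfolding displacement_def
  by (simp add: diff_frac_eq) (simp add: algebra_simps power2_eq_square power3_eq_cube)

lemma displacement_lipschitz: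
  fixes a b x y :: "'p::prime_card padic"
  assumes x: "padic_norm x = r" and y: "padic_norm y = r"
    and Qx: "padic_norm (x\<^sup>2 + a * x + b) = Q" and Qy: "padic_norm (y\<^sup>2 + a * y + b) = Q"
    and "Q > 0"
  shows "dist (displacement a b x) (displacement a b y) \<le>
    max (r ^ 4) (max (padic_norm a * r ^ 3) (padic_norm b * r\<^sup>2)) / Q\<^sup>2 * dist x y"
proof -
  let ?P = "(x * y)\<^sup>2 + a * (x * y * (x + y)) + b * (x\<^sup>2 + x * y + y\<^sup>2)"
  let ?K = "max (r ^ 4) (max (padic_norm a * r ^ 3) (padic_norm b * r\<^sup>2))"
  have r: "r \<ge> 0" using x padic_norm_nonneg by blast
  have nz: "x\<^sup>2 + a * x + b \<noteq> 0" "y\<^sup>2 + a * y + b \<noteq> 0"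
    using Qx Qy \<open>Q > 0\<close> padic_norm_eq_0 by (metis less_irrefl)+
  have t1: "padic_norm ((x * y)\<^sup>2) = r ^ 4"
    by (simp add: padic_norm_power padic_norm_mult x y power2_eq_square eval_nat_numeral)
  have "padic_norm (x + y) \<le> r" using padic_norm_ultra[of x y] x y by simp
  hence "padic_norm (x * y * (x + y)) \<le> r ^ 3"
    using r by (simp add: padic_norm_mult x y power3_eq_cube mult_left_mono)
  hence t2: "padic_norm (a * (x * y * (x + y))) \<le> padic_norm a * r ^ 3"
    by (simp add: padic_norm_mult[of a] mult_left_mono padic_norm_nonneg)
  have "padic_norm (x\<^sup>2 + x * y + y\<^sup>2) \<le> r\<^sup>2"
    using padic_norm_ultra[of "x\<^sup>2 + x * y" "y\<^sup>2"] padic_norm_ultra[of "x\<^sup>2" "x * y"]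
    by (simp add: padic_norm_power padic_norm_mult x y power2_eq_square)
  hence t3: "padic_norm (b * (x\<^sup>2 + x * y + y\<^sup>2)) \<le> padic_norm b * r\<^sup>2"
    by (simp add: padic_norm_mult[of b] mult_left_mono padic_norm_nonneg)
  have "padic_norm ?P \<le> ?K"
    using padic_norm_ultra[of "(x * y)\<^sup>2 + a * (x * y * (x + y))" "b * (x\<^sup>2 + x * y + y\<^sup>2)"]
      padic_norm_ultra[of "(x * y)\<^sup>2" "a * (x * y * (x + y))"] t1 t2 t3 by linarith
  hence "padic_norm (x - y) * padic_norm ?P / Q\<^sup>2 \<le> padic_norm (x - y) * ?K / Q\<^sup>2"
    by (intro divide_right_mono mult_left_mono) (auto simp: padic_norm_nonneg)
  thus ?thesis
    unfolding dist_padic_def displacement_diff[OF nz]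
    by (simp add: padic_norm_mult[of "x - y"] padic_norm_mult[of "x\<^sup>2 + a * x + b"]
        padic_norm_divide Qx Qy power2_eq_square[of Q] mult.commute)
qed

text \<open>The radius is the constant displacement on the sphere. The bound
  \<open>r\<^sup>2 < Q\<close> makes it smaller than \<open>r\<close>, which keeps the ball inside
  the sphere; with the other two bounds it makes the Lipschitz constant \<open>K\<close> of the
  displacement less than 1.\<close>

lemma rat_map_image_ball:
  fixes a b c :: "'p::prime_card padic"
  assumes r: "r > 0" and c: "padic_norm c = r" and "Q > 0"
    and Q: "\<And>x. padic_norm x = r \<Longrightarrow> padic_norm (x\<^sup>2 + a * x + b) = Q"
    and "r\<^sup>2 < Q" "padic_norm a * r ^ 3 < Q\<^sup>2" "padic_norm b * r\<^sup>2 < Q\<^sup>2"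
  defines "V \<equiv> cball c (r ^ 3 / Q)"
  shows "V \<subseteq> sphere 0 r" "rat_map a b ` V = V"
proof -
  let ?d = "displacement a b"
  define \<rho> where "\<rho> = r ^ 3 / Q"
  define K where "K = max (r ^ 4) (max (padic_norm a * r ^ 3) (padic_norm b * r\<^sup>2)) / Q\<^sup>2"
  have "\<rho> < r"
    using \<open>r\<^sup>2 < Q\<close> \<open>Q > 0\<close> r by (simp add: \<rho>_def power3_eq_cube power2_eq_square divide_less_eq mult.assoc)
  have "(r\<^sup>2)\<^sup>2 < Q\<^sup>2" using \<open>r\<^sup>2 < Q\<close> by (intro power_strict_mono) auto
  hence "r ^ 4 < Q\<^sup>2" by simp
  hence K: "0 \<le> K" "K < 1"
    using assms r by (simp_all add: K_def le_max_iff_disj)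
  have V: "x \<in> V \<longleftrightarrow> padic_norm (x - c) \<le> \<rho>" for x
    by (simp add: V_def \<rho>_def dist_padic_def padic_norm_minus_commute)
  have norm: "padic_norm x = r" if "x \<in> V" for x
    using padic_norm_diff_eq_left[of "c - x" c] that \<open>\<rho> < r\<close> c
    by (simp add: V padic_norm_minus_commute)
  thus "V \<subseteq> sphere 0 r"
    by (auto simp: dist_0_padic)
  have nz: "x\<^sup>2 + a * x + b \<noteq> 0" if "x \<in> V" for x
    using Q[OF norm[OF that]] \<open>Q > 0\<close> padic_norm_eq_0[of "x\<^sup>2 + a * x + b"] by auto
  have d: "padic_norm (?d x) = \<rho>" if "x \<in> V" for x
    using norm[OF that] Q by (simp add: displacement_def padic_norm_divide padic_norm_power \<rho>_def)
  \<comment> \<open>In an ultrametric ball of radius \<open>\<rho>\<close>, a shift of norm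
    \<open>\<rho>\<close> does not leave the ball.\<close>
  have sub: "x - ?d x \<in> V" if "x \<in> V" for x
    using padic_norm_ultra_diff[of "x - c" "?d x"] d[OF that] that by (simp add: V algebra_simps)
  show "rat_map a b ` V = V"
  proof (intro equalityI subsetI)
    fix y assume "y \<in> rat_map a b ` V"
    thus "y \<in> V" using sub nz by (auto simp: rat_map_displacement)
  next
    fix y assume y: "y \<in> V"
    have "\<exists>!x\<in>V. y + ?d x = x"
    proof (rule Banach_fix)
      show "complete V" by (simp add: V_def complete_eq_closed)
      show "V \<noteq> {}" using y by auto
      show "0 \<le> K" "K < 1" by (fact K)+
      show "(\<lambda>x. y + ?d x) ` V \<subseteq> V"
      proof safe
        fix x assume "x \<in> V"
        thus "y + ?d x \<in> V"
          using padic_norm_ultra[of "y - c" "?d x"] d[of x] y by (simp add: V algebra_simps)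
      qed
      fix x z assume "x \<in> V" "z \<in> V"
      thus "dist (y + ?d x) (y + ?d z) \<le> K * dist x z"
        using displacement_lipschitz[of x r z a b Q] norm Q \<open>Q > 0\<close>
        by (simp add: K_def dist_padic_def)
    qed
    then obtain x where x: "x \<in> V" "y + ?d x = x" by blast
    have "rat_map a b x = x - ?d x"
      by (rule rat_map_displacement[OF nz[OF x(1)]])
    also have "\<dots> = y" using x(2) by (simp add: diff_eq_eq)
    finally have "rat_map a b x = y" .
    thus "y \<in> rat_map a b ` V" using x by blast
  qed
qed

section \<open>Measurability and measure of balls\<close>

lemma closed_algebra_closedin: "closedin (top_of_set X) C \<Longrightarrow> C \<in> closed_algebra X"
  by (auto simp: closed_algebra_def)

lemma closed_sphere_metric: "closed (sphere (x :: 'a::metric_space) r)"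
  unfolding sphere_def by (intro closed_Collect_eq continuous_intros)

lemma emeasure_sphere_measure_cball:
  fixes c :: "'p::prime_card padic"
  assumes M: "padic_haar M" and sub: "cball c (real CARD('p) powi n) \<subseteq> sphere 0 r" and "r > 0"
  shows "emeasure (sphere_measure M r) (cball c (real CARD('p) powi n)) =
    ennreal (real CARD('p) powi n / r)"
proof -
  have sets: "sets M = sets borel"
    and ball: "emeasure M (cball c (real CARD('p) powi n)) = ennreal (real CARD('p) powi n)"
    using M by (auto simp: padic_haar_def)
  have "emeasure (restrict_space M (sphere 0 r)) (cball c (real CARD('p) powi n)) =
      emeasure M (cball c (real CARD('p) powi n))"
    using sub sets by (intro emeasure_restrict_space)
      (simp_all add: sets_eq_imp_space_eq[OF sets] borel_closed closed_sphere_metric)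
  thus ?thesis
    using \<open>r > 0\<close> by (simp add: sphere_measure_def ball flip: ennreal_mult)
qed

theorem theorem12:
  fixes a b x1 x2 :: "'p::prime_card padic"
    and M :: "'p padic measure"
    and r :: real
  assumes "a \<noteq> 0"
    and "\<exists>s. s\<^sup>2 = a\<^sup>2 - 4 * b"
    and "{x. x\<^sup>2 + a * x + b = 0} = {x1, x2}"
    and "padic_norm x1 \<le> padic_norm x2"
    and "padic_haar M"
    and "r \<in> invariant_radii (padic_norm a) (padic_norm x1) (padic_norm x2)"
    and "r > 0"
    and "sphere (0 :: 'p padic) r \<noteq> {}"
  shows "\<not> ergodic (sphere 0 r) (rat_map a b) (sphere_measure M r)"
proof -
  define \<alpha> where "\<alpha> = padic_norm x1"
  define \<beta> where "\<beta> = padic_norm x2"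
  \<comment> \<open>On the sphere \<open>|x - x1| = max r \<alpha>\<close> because
    \<open>r \<noteq> \<alpha>\<close>, and \<open>|x - x2| = \<beta>\<close> because
    \<open>r < \<beta>\<close>.\<close>
  define Q where "Q = max r \<alpha> * \<beta>"
  note vieta = monic_quadratic_vieta[OF assms(1,3)]
  have \<alpha>: "\<alpha> \<ge> 0" by (simp add: \<alpha>_def padic_norm_nonneg)
  \<comment> \<open>These three facts hold in both cases of \<open>invariant_radii\<close>, so no
    further case distinction is made.\<close>
  have radii: "padic_norm a \<le> \<beta>" "r < \<beta>" "r \<noteq> \<alpha>"
    using assms(6) by (auto simp: invariant_radii_def \<alpha>_def \<beta>_def split: if_splits)
  have m: "r \<le> max r \<alpha>" "\<alpha> \<le> max r \<alpha>" "0 < max r \<alpha>" using \<open>r > 0\<close> by auto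
  have "Q > 0" using m radii \<open>r > 0\<close> by (simp add: Q_def)
  have Q: "padic_norm (x\<^sup>2 + a * x + b) = Q" if "padic_norm x = r" for x
  proof -
    have "x\<^sup>2 + a * x + b = (x - x1) * (x - x2)"
      by (simp add: vieta power2_eq_square algebra_simps)
    thus ?thesis
      using padic_norm_diff_eq_max[of x x1] padic_norm_diff_eq_max[of x x2] that radii
      by (simp add: padic_norm_mult Q_def \<alpha>_def \<beta>_def)
  qed
  have "r * r < max r \<alpha> * \<beta>"
    using m radii \<open>r > 0\<close> by (intro mult_le_less_imp_less) auto
  hence rQ: "r\<^sup>2 < Q" by (simp add: Q_def power2_eq_square)
  \<comment> \<open>Applied to \<open>t = |a| r\<close> and to \<open>t = |b|\<close>, where
    \<open>|b| = \<alpha> \<beta>\<close> by Vieta.\<close>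
  have QQ: "t * r\<^sup>2 < Q * Q" if "t \<le> Q" for t
    using mult_right_mono[OF that, of "r\<^sup>2"] mult_strict_left_mono[OF rQ \<open>Q > 0\<close>] by simp
  have "padic_norm a * r \<le> \<beta> * max r \<alpha>"
    using m radii \<open>r > 0\<close> by (intro mult_mono) auto
  hence "padic_norm a * r \<le> Q" by (simp add: Q_def mult.commute)
  hence "(padic_norm a * r) * r\<^sup>2 < Q * Q"
    by (rule QQ)
  hence aQ: "padic_norm a * r ^ 3 < Q\<^sup>2"
    by (simp add: power2_eq_square power3_eq_cube mult_ac)
  have "padic_norm b \<le> Q"
    using m radii \<open>r > 0\<close>
    by (simp add: vieta padic_norm_mult Q_def \<alpha>_def \<beta>_def mult_right_mono padic_norm_nonneg)
  hence "padic_norm b * r\<^sup>2 < Q * Q" by (rule QQ)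
  hence bQ: "padic_norm b * r\<^sup>2 < Q\<^sup>2" by (simp add: power2_eq_square)
  obtain c :: "'p padic" where c: "padic_norm c = r"
    using assms(8) unfolding ex_in_conv[symmetric] mem_sphere dist_0_padic by blast
  let ?V = "cball c (r ^ 3 / Q)"
  note ball = rat_map_image_ball[OF \<open>r > 0\<close> c \<open>Q > 0\<close> Q rQ aQ bQ]
  \<comment> \<open>The radius is the norm of a nonzero element, hence a power of the prime, so the
    Haar normalization applies to \<open>?V\<close>.\<close>
  have disp: "padic_norm (displacement a b c) = r ^ 3 / Q"
    by (simp add: displacement_def padic_norm_divide padic_norm_power c Q)
  hence "displacement a b c \<noteq> 0"
    using \<open>r > 0\<close> \<open>Q > 0\<close> padic_norm_eq_0[of "displacement a b c"] by auto
  then obtain n :: int where "padic_norm (displacement a b c) = real CARD('p) powi n"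
    by (rule padic_norm_value)
  hence n: "r ^ 3 / Q = real CARD('p) powi n" by (simp only: disp)
  have inv: "?V \<in> closed_algebra (sphere 0 r)"
    using ball(1) by (intro closed_algebra_closedin closed_subset) auto
  have mu: "emeasure (sphere_measure M r) ?V = ennreal (r ^ 3 / Q / r)"
    using emeasure_sphere_measure_cball[OF assms(5) _ \<open>r > 0\<close>] ball(1) by (simp add: n)
  \<comment> \<open>The value is \<open>r\<^sup>2 / Q\<close>. Comparison is with the literal 1,
    which also covers the prime 2 with radius \<open>r / 2\<close>, where the ball is the whole
    sphere.\<close>
  have "0 < r ^ 3 / Q / r" "r ^ 3 / Q / r < 1"
    using rQ \<open>r > 0\<close> \<open>Q > 0\<close> by (simp_all add: power3_eq_cube power2_eq_square)
  hence ne: "\<not> (emeasure (sphere_measure M r) ?V = 0 \<or> emeasure (sphere_measure M r) ?V = 1)"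
    unfolding mu ennreal_eq_1 ennreal_eq_0_iff by linarith
  show ?thesis
  proof
    assume "ergodic (sphere 0 r) (rat_map a b) (sphere_measure M r)"
    from mp[OF bspec[OF this[unfolded ergodic_def] inv] ball(2)] ne
    show False by (rule notE[rotated])
  qed
qed

end
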